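(* Let $p\ge 2$ be an integer, let $\beta>0$, and put $a=\frac{p}{p+1}$ and $\lambda=\frac{2\pi\beta}{a}$. If $\Delta_p(\beta)=0$, then the Gabor system $\mathcal G(h_\lambda,a,1)$ is not a frame for $L^2(\mathbb{R})$.
   Context: For a nonzero $h\in L^2(\mathbb{R})$ and $\alpha,b>0$, the Gabor system is $\mathcal G(h,\alpha,b)=\{x\mapsto e^{2\pi i b m x}h(x-\alpha k): k,m\in\mathbb{Z}\}$; it is a frame for $L^2(\mathbb{R})$ if there exist constants $A,B>0$ such that for every $f\in L^2(\mathbb{R})$, $A\|f\|^2\le\sum_{m,k\in\mathbb{Z}}|\langle f,e^{2\pi i b m\cdot}h(\cdot-\alpha k)\rangle|^2\le B\|f\|^2$. For $\lambda>0$ define $h_\lambda(\xi)=e^{-\lambda|\xi|}-2e^{-2\lambda|\xi|}+e^{-3\lambda|\xi|}$ for $\xi\in\mathbb{R}$, and for an integer $p\ge2$ define $$H_{\lambda,p}(y)=\sum_{n\in\mathbb{Z}}(-1)^n h_\lambda(y+np),\qquad y\in\mathbb{R}.$$ With $a=\frac{p}{p+1}$ and $\lambda=\frac{2\pi\beta}{a}$, the real number $\Delta_p(\beta)$ is defined as follows. If $p=2m$ is even, $\Delta_p(\beta)=\det B_p^+(\beta)$, where $B_p^+(\beta)$ is the $m\times m$ real matrix with rows indexed by $1\le s\le m$ and columns by $1\le k\le m$ and entries $$(B_p^+)_{s,k}=\sqrt p\,\bigl[H_{\lambda,p}(as+k)+H_{\lambda,p}(as+p-k)\bigr]\quad(1\le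 k<m),\qquad (B_p^+)_{s,m}=\sqrt{2p}\,H_{\lambda,p}\!\left(as+\tfrac p2\right).$$ If $p=2m-1$ is odd, $\Delta_p(\beta)=\det B_p^-(\beta)$, where $B_p^-(\beta)$ is the $m\times m$ real matrix with rows indexed by $0\le s\le m-1$ and columns by $0\le k\le m-1$ and entries $$(B_p^-)_{0,0}=\sqrt p\,H_{\lambda,p}(0),\quad (B_p^-)_{0,k}=\sqrt{2p}\,H_{\lambda,p}(k)\ (1\le k\le m-1),\quad (B_p^-)_{s,0}=\sqrt{2p}\,H_{\lambda,p}(as)\ (1\le s\le m-1),$$ $$(B_p^-)_{s,k}=\sqrt p\,\bigl[H_{\lambda,p}(as+k)-H_{\lambda,p}(as+p-k)\bigr]\quad(1\le s,k\le m-1).$$ *)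

theory Defs
  imports "HOL-Analysis.Analysis" "Jordan_Normal_Form.Determinant"
begin

(* Elements of L^2(R) are represented by functions; equality almost everywhere is not
   quotiented out, since the inner product and the norm below do not see null sets. *)
definition L2_space :: "(real \<Rightarrow> complex) set" where
  "L2_space = {f. f \<in> borel_measurable lebesgue \<and> integrable lebesgue (\<lambda>x. (cmod (f x))\<^sup>2)}"

definition L2_inner :: "(real \<Rightarrow> complex) \<Rightarrow> (real \<Rightarrow> complex) \<Rightarrow> complex" where
  "L2_inner f g = (LINT x|lebesgue. f x * cnj (g x))"

definition norm_L2 :: "(real \<Rightarrow> complex) \<Rightarrow> real" where
  "norm_L2 f = sqrt (LINT x|lebesgue. (cmod (f x))\<^sup>2)"

(* The summability conjunct is part of the upper bound: without it, infsum would return 0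
   on a divergent sum. *)
definition L2_frame :: "('i \<Rightarrow> real \<Rightarrow> complex) \<Rightarrow> bool" where
  "L2_frame g \<longleftrightarrow> (\<exists>A B. 0 < A \<and> 0 < B \<and>
     (\<forall>f\<in>L2_space.
        (\<lambda>i. (cmod (L2_inner f (g i)))\<^sup>2) summable_on UNIV \<and>
        A * (norm_L2 f)\<^sup>2 \<le> (\<Sum>\<^sub>\<infinity>i. (cmod (L2_inner f (g i)))\<^sup>2) \<and>
        (\<Sum>\<^sub>\<infinity>i. (cmod (L2_inner f (g i)))\<^sup>2) \<le> B * (norm_L2 f)\<^sup>2))"

(* A family indexed by pairs (k, m), as the frame inequality sums over the indices. *)
definition gabor_system :: "(real \<Rightarrow> complex) \<Rightarrow> real \<Rightarrow> real \<Rightarrow> int \<times> int \<Rightarrow> real \<Rightarrow> complex" where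
  "gabor_system h \<alpha> b = (\<lambda>(k, m) x.
     exp (2 * of_real pi * \<i> * of_real b * of_int m * of_real x) * h (x - \<alpha> * of_int k))"

definition h_win :: "real \<Rightarrow> real \<Rightarrow> real" where
  "h_win lam \<xi> = exp (- lam * \<bar>\<xi>\<bar>) - 2 * exp (- 2 * lam * \<bar>\<xi>\<bar>) + exp (- 3 * lam * \<bar>\<xi>\<bar>)"

definition H_per :: "real \<Rightarrow> nat \<Rightarrow> real \<Rightarrow> real" where
  "H_per lam p y = (\<Sum>\<^sub>\<infinity>n::int. (- 1) powi n * h_win lam (y + of_int n * real p))"

definition shift_par :: "nat \<Rightarrow> real" where
  "shift_par p = real p / (real p + 1)"

definition lam_par :: "nat \<Rightarrow> real \<Rightarrow> real" where
  "lam_par p \<beta> = 2 * pi * \<beta> / shift_par p"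

(* For p = 2 m. Rows and columns of mat are counted from 0, those of B_p^+ from 1. *)
definition B_plus :: "nat \<Rightarrow> real \<Rightarrow> real mat" where
  "B_plus p \<beta> = (let m = p div 2; a = shift_par p; H = H_per (lam_par p \<beta>) p in
     mat m m (\<lambda>(i, j). let s = i + 1; k = j + 1 in
       if k < m
       then sqrt (real p) * (H (a * real s + real k) + H (a * real s + real p - real k))
       else sqrt (2 * real p) * H (a * real s + real p / 2)))"

(* For p = 2 m - 1. *)
definition B_minus :: "nat \<Rightarrow> real \<Rightarrow> real mat" where
  "B_minus p \<beta> = (let m = (p + 1) div 2; a = shift_par p; H = H_per (lam_par p \<beta>) p in
     mat m m (\<lambda>(s, k).
       if s = 0 \<and> k = 0 then sqrt (real p) * H 0
       else if s = 0 then sqrt (2 * real p) * H (real k)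
       else if k = 0 then sqrt (2 * real p) * H (a * real s)
       else sqrt (real p) * (H (a * real s + real k) - H (a * real s + real p - real k))))"

definition Delta :: "nat \<Rightarrow> real \<Rightarrow> real" where
  "Delta p \<beta> = (if even p then Determinant.det (B_plus p \<beta>) else Determinant.det (B_minus p \<beta>))"

end

theory Submission
  imports Defs
begin

text \<open>
  A Gabor system with modulation step 1 acts fibre by fibre: on functions living near
  \<open>x + \<int>\<close> its analysis operator is the infinite matrix \<open>(h (x + j - a k))\<close> with rows \<open>k\<close> and columns
  \<open>j\<close>, and a lower frame bound forces these matrices to be bounded below. So it is enough to find a
  bounded sequence \<open>c\<close>, not square summable, that is annihilated by the matrix at \<open>x = 0\<close>; its
  truncations, spread over short intervals, then have large norm and bounded frame sum
  (\<open>bounded_kernel_sequence_imp_not_frame\<close>).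

  The sequence is sought with \<open>c (j + p) = - c j\<close>. Summing over residue classes modulo \<open>p\<close> replaces
  \<open>h\<close> by its alternating periodisation \<open>H\<close> (\<open>antiperiodic_ext_has_sum\<close>), and since
  \<open>a (p + 1) = p\<close> there remain \<open>p + 1\<close> equations in \<open>p\<close> unknowns. This system looks overdetermined,
  but \<open>H\<close> is even, and imposing a parity on \<open>c\<close> (odd for even \<open>p\<close>, even for odd \<open>p\<close>) makes one
  of the equations hold identically and lets the others repeat under reflection (\<open>fiber_sum_eq_0\<close>). What is left
  is a square system whose matrix is, up to nonzero row and column factors, the one defining
  \<open>\<Delta>\<^sub>p(\<beta>)\<close>; a vanishing determinant therefore yields a nonzero \<open>c\<close>
  (\<open>B_plus_singular_imp_kernel\<close>, \<open>B_minus_singular_imp_kernel\<close>), and antiperiodicity makes it bounded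
  and not square summable.
\<close>

section \<open>Exponential sums over lattices\<close>

lemma sum_geometric_abs_le:
  fixes q :: real and K :: "int set"
  assumes q: "0 \<le> q" "q < 1" and K: "finite K"
  shows "(\<Sum>n\<in>K. q ^ nat \<bar>n\<bar>) \<le> 2 / (1 - q)"
proof -
  have part: "(\<Sum>n\<in>L. q ^ nat \<bar>n\<bar>) \<le> 1 / (1 - q)"
    if "finite L" "inj_on (\<lambda>n. nat \<bar>n\<bar>) L" for L :: "int set"
  proof -
    have "(\<Sum>n\<in>L. q ^ nat \<bar>n\<bar>) = (\<Sum>i\<in>(\<lambda>n. nat \<bar>n\<bar>) ` L. q ^ i)"
      using that by (simp add: sum.reindex)
    also have "\<dots> \<le> (\<Sum>i. q ^ i)"
      using q that by (intro sum_le_suminf) (auto intro: summable_geometric)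
    also have "\<dots> = 1 / (1 - q)"
      using q by (simp add: suminf_geometric)
    finally show ?thesis .
  qed
  have "(\<Sum>n\<in>K. q ^ nat \<bar>n\<bar>)
      = (\<Sum>n\<in>K \<inter> {0..}. q ^ nat \<bar>n\<bar>) + (\<Sum>n\<in>K \<inter> {..<0}. q ^ nat \<bar>n\<bar>)"
    using K by (subst sum.union_disjoint [symmetric]) (auto intro!: sum.cong)
  also have "\<dots> \<le> 1 / (1 - q) + 1 / (1 - q)"
    using K by (intro add_mono part) (auto simp: inj_on_def)
  finally show ?thesis by simp
qed

text \<open>The bound is uniform in \<open>y\<close> because shifting the index by \<open>\<lfloor>y / \<theta>\<rfloor>\<close> brings \<open>y\<close> into one period,
  at the cost of a factor \<open>exp (lam * \<theta>)\<close>.\<close>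
lemma exp_lattice_sum_bounded:
  fixes lam \<theta> :: real
  assumes lam: "lam > 0" and \<theta>: "\<theta> > 0"
  obtains S where "S > 0"
    and "\<And>y (K :: int set). finite K \<Longrightarrow> (\<Sum>k\<in>K. exp (- lam * \<bar>y - \<theta> * of_int k\<bar>)) \<le> S"
proof
  define q where "q = exp (- lam * \<theta>)"
  have q: "0 < q" "q < 1" using lam \<theta> by (auto simp: q_def)
  show "exp (lam * \<theta>) * (2 / (1 - q)) > 0" using q by simp
  fix y :: real and K :: "int set"
  assume K: "finite K"
  define k0 where "k0 = \<lfloor>y / \<theta>\<rfloor>"
  have le: "exp (- lam * \<bar>y - \<theta> * of_int k\<bar>) \<le> exp (lam * \<theta>) * q ^ nat \<bar>k - k0\<bar>" for k :: int
  proof -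
    have "of_int k0 \<le> y / \<theta>" "y / \<theta> < of_int k0 + 1"
      unfolding k0_def by linarith+
    then have "\<theta> * of_int k0 \<le> y" "y < \<theta> * of_int k0 + \<theta>"
      using \<theta> by (auto simp: field_simps)
    moreover have "\<theta> * \<bar>of_int (k - k0)\<bar> = \<bar>\<theta> * of_int k - \<theta> * of_int k0\<bar>"
      using \<theta> by (simp add: abs_mult right_diff_distrib [symmetric])
    ultimately have "\<theta> * \<bar>of_int (k - k0)\<bar> - \<theta> \<le> \<bar>y - \<theta> * of_int k\<bar>" by linarith
    then have "lam * (\<theta> * \<bar>of_int (k - k0)\<bar> - \<theta>) \<le> lam * \<bar>y - \<theta> * of_int k\<bar>"
      using lam by simp
    then have "exp (- lam * \<bar>y - \<theta> * of_int k\<bar>)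
        \<le> exp (lam * \<theta> + of_nat (nat \<bar>k - k0\<bar>) * (- lam * \<theta>))"
      by (simp add: algebra_simps)
    also have "\<dots> = exp (lam * \<theta>) * q ^ nat \<bar>k - k0\<bar>"
      by (simp only: exp_add exp_of_nat_mult q_def)
    finally show ?thesis .
  qed
  have "(\<Sum>k\<in>K. exp (- lam * \<bar>y - \<theta> * of_int k\<bar>))
      \<le> exp (lam * \<theta>) * (\<Sum>k\<in>K. q ^ nat \<bar>k - k0\<bar>)"
    unfolding sum_distrib_left by (intro sum_mono le)
  also have "(\<Sum>k\<in>K. q ^ nat \<bar>k - k0\<bar>) = (\<Sum>n\<in>(\<lambda>k. k - k0) ` K. q ^ nat \<bar>n\<bar>)"
    by (simp add: sum.reindex inj_on_def)
  also have "\<dots> \<le> 2 / (1 - q)"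
    using K q by (intro sum_geometric_abs_le) auto
  finally show "(\<Sum>k\<in>K. exp (- lam * \<bar>y - \<theta> * of_int k\<bar>)) \<le> exp (lam * \<theta>) * (2 / (1 - q))"
    by simp
qed

section \<open>Bessel's inequality for exponentials\<close>

text \<open>Supplies the upper bound for the frame sum: for each translation index the modulations are
  orthonormal on a period.\<close>
lemma bessel_inequality:
  fixes e :: "'i \<Rightarrow> 'a \<Rightarrow> complex" and g :: "'a \<Rightarrow> complex"
  assumes I: "finite I"
    and ge: "\<And>i. i \<in> I \<Longrightarrow> integrable M (\<lambda>x. g x * cnj (e i x))"
    and ee: "\<And>i j. i \<in> I \<Longrightarrow> j \<in> I \<Longrightarrow> integrable M (\<lambda>x. e i x * cnj (e j x))"
    and orth: "\<And>i j. i \<in> I \<Longrightarrow> j \<in> I \<Longrightarrow> (LINT x|M. e i x * cnj (e j x)) = (if i = j then 1 else 0)"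
    and g: "integrable M (\<lambda>x. (cmod (g x))\<^sup>2)"
  shows "(\<Sum>i\<in>I. (cmod (LINT x|M. g x * cnj (e i x)))\<^sup>2) \<le> (LINT x|M. (cmod (g x))\<^sup>2)"
proof -
  define u where "u i = (LINT x|M. g x * cnj (e i x))" for i
  define P where "P x = (\<Sum>i\<in>I. u i * e i x)" for x
  have gP: "g x * cnj (P x) = (\<Sum>i\<in>I. cnj (u i) * (g x * cnj (e i x)))" for x
    by (simp add: P_def sum_distrib_left mult_ac)
  have PP: "P x * cnj (P x) = (\<Sum>i\<in>I. \<Sum>j\<in>I. u i * cnj (u j) * (e i x * cnj (e j x)))" for x
    by (simp add: P_def sum_product mult_ac)
  have int_gP: "integrable M (\<lambda>x. g x * cnj (P x))"
    unfolding gP by (intro Bochner_Integration.integrable_sum integrable_mult_right ge)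
  have int_PP: "integrable M (\<lambda>x. P x * cnj (P x))"
    unfolding PP by (intro Bochner_Integration.integrable_sum integrable_mult_right ee)
  have LgP: "(LINT x|M. g x * cnj (P x)) = of_real (\<Sum>i\<in>I. (cmod (u i))\<^sup>2)"
    unfolding gP using ge
    by (subst Bochner_Integration.integral_sum)
       (auto simp: u_def [symmetric] complex_norm_square mult.commute simp del: of_real_power)
  have LPP: "(LINT x|M. P x * cnj (P x)) = of_real (\<Sum>i\<in>I. (cmod (u i))\<^sup>2)"
  proof -
    have "(LINT x|M. P x * cnj (P x)) = (\<Sum>i\<in>I. \<Sum>j\<in>I. u i * cnj (u j) * (if i = j then 1 else 0))"
      unfolding PP using ee
      by (subst Bochner_Integration.integral_sum,
          force intro!: Bochner_Integration.integrable_sum,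
          intro sum.cong refl,
          subst Bochner_Integration.integral_sum) (auto simp: orth intro!: sum.cong)
    also have "\<dots> = (\<Sum>i\<in>I. u i * cnj (u i))"
      using I by (intro sum.cong refl) (simp add: if_distrib cong: if_cong)
    finally show ?thesis by (simp add: complex_norm_square del: of_real_power)
  qed
  define r s where "r x = g x * cnj (P x)" and "s x = P x * cnj (P x)" for x
  have eq: "(cmod (g x - P x))\<^sup>2 = (cmod (g x))\<^sup>2 - 2 * Re (r x) + Re (s x)" for x
    unfolding cmod_power2 r_def s_def by (simp add: power2_eq_square algebra_simps)
  have "0 \<le> (LINT x|M. (cmod (g x - P x))\<^sup>2)"
    by simp
  also have "\<dots> = (LINT x|M. (cmod (g x))\<^sup>2) - 2 * Re (LINT x|M. r x) + Re (LINT x|M. s x)"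
    using g int_gP int_PP unfolding eq r_def [symmetric] s_def [symmetric] by simp
  also have "\<dots> = (LINT x|M. (cmod (g x))\<^sup>2) - (\<Sum>i\<in>I. (cmod (u i))\<^sup>2)"
    by (simp add: LgP LPP r_def s_def)
  finally show ?thesis by (simp add: u_def)
qed

lemma character_integral:
  "has_bochner_integral lborel (\<lambda>x. indicator {0..1} x *\<^sub>R exp (2 * of_real pi * \<i> * of_int n * of_real x))
     (if n = 0 then 1 else 0 :: complex)"
proof (cases "n = 0")
  case True
  have "has_bochner_integral lborel (\<lambda>x. indicator {0..1::real} x *\<^sub>R (1::complex)) (complex_of_real 1 - complex_of_real 0)"
    by (rule has_bochner_integral_FTC_Icc) (auto intro!: derivative_eq_intros simp: has_vector_derivative_def scaleR_conv_of_real)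
  with True show ?thesis by simp
next
  case False
  define w where "w = 2 * of_real pi * \<i> * of_int n"
  have w: "w \<noteq> 0" using False by (simp add: w_def)
  have "exp w = 1"
    unfolding w_def using exp_integer_2pi [of "of_int n"] by (simp add: mult_ac)
  moreover have "has_bochner_integral lborel (\<lambda>x. indicator {0..1} x *\<^sub>R exp (w * of_real x))
     (exp (w * of_real 1) / w - exp (w * of_real 0) / w)"
  proof (rule has_bochner_integral_FTC_Icc)
    fix x :: real
    have "((\<lambda>z. exp (w * z) / w) has_field_derivative exp (w * of_real x)) (at (of_real x))"
      using w by (auto intro!: derivative_eq_intros)
    from has_vector_derivative_real_field [OF this]
    show "((\<lambda>x. exp (w * complex_of_real x) / w) has_vector_derivative exp (w * of_real x)) (at x within {0..1})"
      by simp
  qed (auto intro!: continuous_intros)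
  ultimately show ?thesis using False by (simp add: w_def mult_ac)
qed

lemma integrable_bounded_support:
  fixes f :: "real \<Rightarrow> complex"
  assumes "f \<in> borel_measurable borel"
    and "\<And>x. x \<notin> {u..<v} \<Longrightarrow> f x = 0" and "\<And>x. cmod (f x) \<le> b"
  shows "integrable lborel f"
proof (rule Bochner_Integration.integrable_bound)
  show "integrable lborel (\<lambda>x. b * indicator {u..<v} x :: real)"
    by (cases "u \<le> v") auto
  have "cmod (f x) \<le> norm (b * indicator {u..<v} x)" for x
    using assms(2,3) [of x] norm_ge_zero [of "f x"] by (cases "x \<in> {u..<v}") auto
  then show "AE x in lborel. cmod (f x) \<le> norm (b * indicator {u..<v} x)" by simp
qed (use assms in simp)

lemma fourier_coefficients_le:
  fixes w :: "real \<Rightarrow> complex" and I :: "int set"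
  assumes w: "w \<in> borel_measurable borel" and \<delta>: "0 < \<delta>" "\<delta> \<le> 1"
    and supp: "\<And>x. x \<notin> {0..<\<delta>} \<Longrightarrow> w x = 0" and b: "\<And>x. (cmod (w x))\<^sup>2 \<le> b"
    and I: "finite I"
  shows "(\<Sum>m\<in>I. (cmod (LINT x|lborel. w x * cnj (exp (2 * of_real pi * \<i> * of_int m * of_real x))))\<^sup>2)
    \<le> \<delta> * b"
proof -
  define e where "e m x = indicator {0..1} x *\<^sub>R exp (2 * of_real pi * \<i> * of_int m * of_real x)"
    for m :: int and x :: real
  have e1: "cmod (e m x) \<le> 1" for m x
    by (auto simp: e_def indicator_def norm_exp_eq_Re)
  have b0: "0 \<le> b" using b [of 0] by (meson order_trans zero_le_power2)
  have w_le: "cmod (w x) \<le> sqrt b" for x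
    using b [of x] by (simp add: real_le_rsqrt)
  have we: "w x * cnj (exp (2 * of_real pi * \<i> * of_int m * of_real x)) = w x * cnj (e m x)" for m x
    using supp [of x] \<delta> by (cases "x \<in> {0..<\<delta>}") (auto simp: e_def)
  have meas_e: "e m \<in> borel_measurable borel" for m
  proof -
    have "(\<lambda>x. exp (2 * of_real pi * \<i> * of_int m * complex_of_real x)) \<in> borel_measurable borel"
      by (intro borel_measurable_continuous_onI continuous_intros)
    then show ?thesis unfolding e_def by measurable
  qed
  have ee: "has_bochner_integral lborel (\<lambda>x. e i x * cnj (e j x)) (if i = j then 1 else 0)" for i j
  proof -
    have "e i x * cnj (e j x) = indicator {0..1} x *\<^sub>R exp (2 * of_real pi * \<i> * of_int (i - j) * of_real x)" for x
      by (simp add: e_def indicator_def exp_cnj mult_exp_exp algebra_simps)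
    then show ?thesis using character_integral [of "i - j"] by simp
  qed
  have int_w2: "integrable lborel (\<lambda>x. (cmod (w x))\<^sup>2)"
  proof (rule Bochner_Integration.integrable_bound)
    show "integrable lborel (\<lambda>x. b * indicator {0..<\<delta>} x :: real)" using \<delta> by auto
    show "AE x in lborel. norm ((cmod (w x))\<^sup>2) \<le> norm (b * indicator {0..<\<delta>} x)"
      using supp b b0 by (auto simp: indicator_def)
  qed (use w in simp)
  have "(\<Sum>m\<in>I. (cmod (LINT x|lborel. w x * cnj (e m x)))\<^sup>2) \<le> (LINT x|lborel. (cmod (w x))\<^sup>2)"
  proof (rule bessel_inequality)
    show "integrable lborel (\<lambda>x. w x * cnj (e m x))" for m
    proof (rule integrable_bounded_support)
      show "(\<lambda>x. w x * cnj (e m x)) \<in> borel_measurable borel"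
        by (intro borel_measurable_times w measurable_compose [OF meas_e]
            borel_measurable_continuous_onI continuous_intros)
      show "w x * cnj (e m x) = 0" if "x \<notin> {0..<\<delta>}" for x
        using supp [OF that] by simp
      show "cmod (w x * cnj (e m x)) \<le> sqrt b * 1" for x
        unfolding norm_mult complex_mod_cnj using w_le e1 b0 by (intro mult_mono) auto
    qed
  qed (use I int_w2 ee in \<open>auto simp: has_bochner_integral_iff\<close>)
  also have "\<dots> \<le> (LINT x|lborel. b * indicator {0..<\<delta>} x)"
  proof (rule integral_mono)
    show "integrable lborel (\<lambda>x. b * indicator {0..<\<delta>} x :: real)" using \<delta> by auto
    show "(cmod (w x))\<^sup>2 \<le> b * indicator {0..<\<delta>} x" for x
      using supp [of x] b [of x] by (auto simp: indicator_def)
  qed (rule int_w2)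
  also have "\<dots> = \<delta> * b" using \<delta> by simp
  finally show ?thesis by (simp add: we)
qed

section \<open>Gabor coefficients of pulse trains\<close>

definition pulse_train :: "(int \<Rightarrow> real) \<Rightarrow> int set \<Rightarrow> real \<Rightarrow> real \<Rightarrow> real" where
  "pulse_train c J \<delta> x = (\<Sum>j\<in>J. c j * indicator {of_int j..<of_int j + \<delta>} x)"

lemma pulse_train_measurable [measurable]: "pulse_train c J \<delta> \<in> borel_measurable borel"
  unfolding pulse_train_def [abs_def] by measurable

text \<open>No cross terms occur: as \<open>\<delta> \<le> 1\<close>, the pulses have disjoint supports, and only the one at
  \<open>\<lfloor>x\<rfloor>\<close> can be nonzero at \<open>x\<close>.\<close>
lemma pulse_train_square:
  assumes "finite J" and \<delta>: "\<delta> \<le> 1"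
  shows "(pulse_train c J \<delta> x)\<^sup>2 = (\<Sum>j\<in>J. (c j)\<^sup>2 * indicator {of_int j..<of_int j + \<delta>} x)"
proof -
  have ind: "indicator {of_int j..<of_int j + \<delta>} x
      = (if j = \<lfloor>x\<rfloor> then indicator {0..<\<delta>} (frac x) else 0 :: real)" for j :: int
  proof (cases "j = \<lfloor>x\<rfloor>")
    case True
    then show ?thesis by (auto simp: indicator_def frac_def)
  next
    case False
    then have "\<not> (of_int j \<le> x \<and> x < of_int j + \<delta>)"
      using \<delta> by (metis floor_unique add_le_cancel_left order_less_le_trans)
    with False show ?thesis by (auto simp: indicator_def)
  qed
  show ?thesis
    using assms by (cases "frac x \<in> {0..<\<delta>}") (simp_all add: pulse_train_def ind if_distrib [of "(*) _"] power2_eq_square cong: if_cong)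
qed

lemma pulse_train_in_L2:
  assumes "finite J" and \<delta>: "0 < \<delta>" "\<delta> \<le> 1"
  shows "(\<lambda>x. complex_of_real (pulse_train c J \<delta> x)) \<in> L2_space"
    and "(norm_L2 (\<lambda>x. complex_of_real (pulse_train c J \<delta> x)))\<^sup>2 = \<delta> * (\<Sum>j\<in>J. (c j)\<^sup>2)"
proof -
  have sq: "(cmod (complex_of_real (pulse_train c J \<delta> x)))\<^sup>2
      = (\<Sum>j\<in>J. (c j)\<^sup>2 * indicator {of_int j..<of_int j + \<delta>} x)" for x
    using pulse_train_square [OF assms(1,3)] by simp
  have int: "integrable lborel (\<lambda>x. (cmod (complex_of_real (pulse_train c J \<delta> x)))\<^sup>2)"
    unfolding sq using \<delta> by (intro Bochner_Integration.integrable_sum) auto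
  have meas: "(\<lambda>x. complex_of_real (pulse_train c J \<delta> x)) \<in> borel_measurable lborel" by measurable
  have "integrable lebesgue (\<lambda>x. (cmod (complex_of_real (pulse_train c J \<delta> x)))\<^sup>2)"
    using int by (subst integrable_completion) auto
  moreover have "(\<lambda>x. complex_of_real (pulse_train c J \<delta> x)) \<in> borel_measurable lebesgue"
    using meas by (rule measurable_completion)
  ultimately show "(\<lambda>x. complex_of_real (pulse_train c J \<delta> x)) \<in> L2_space"
    unfolding L2_space_def by simp
  have "(norm_L2 (\<lambda>x. complex_of_real (pulse_train c J \<delta> x)))\<^sup>2
      = (LINT x|lebesgue. (cmod (complex_of_real (pulse_train c J \<delta> x)))\<^sup>2)"
    unfolding norm_L2_def by (simp add: integral_nonneg_AE)
  also have "\<dots> = (LINT x|lborel. (cmod (complex_of_real (pulse_train c J \<delta> x)))\<^sup>2)"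
    using int by (subst integral_completion) auto
  also have "\<dots> = (\<Sum>j\<in>J. (LINT x|lborel. (c j)\<^sup>2 * indicator {of_int j..<of_int j + \<delta>} x))"
    unfolding sq using \<delta> by (subst Bochner_Integration.integral_sum) auto
  also have "\<dots> = \<delta> * (\<Sum>j\<in>J. (c j)\<^sup>2)"
    using \<delta> by (simp add: sum_distrib_left mult.commute)
  finally show "(norm_L2 (\<lambda>x. complex_of_real (pulse_train c J \<delta> x)))\<^sup>2 = \<delta> * (\<Sum>j\<in>J. (c j)\<^sup>2)" .
qed

text \<open>The modulations have period 1, so translating every pulse back to the origin turns the Gabor
  coefficients for a fixed \<open>k\<close> into the Fourier coefficients of one function on \<open>[0, \<delta>)\<close>.\<close>
lemma pulse_train_gabor_inner:
  fixes h :: "real \<Rightarrow> real" and k m :: int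
  assumes J: "finite J" and \<delta>: "0 < \<delta>" and h: "continuous_on UNIV h" and h1: "\<And>x. \<bar>h x\<bar> \<le> 1"
  shows "L2_inner (\<lambda>x. complex_of_real (pulse_train c J \<delta> x))
      (gabor_system (\<lambda>x. complex_of_real (h x)) a 1 (k, m))
    = (LINT x|lborel. of_real (indicator {0..<\<delta>} x * (\<Sum>j\<in>J. c j * h (x + of_int j - a * of_int k)))
        * cnj (exp (2 * of_real pi * \<i> * of_int m * of_real x)))"
proof -
  define E where "E x = cnj (exp (2 * of_real pi * \<i> * of_int m * complex_of_real x))" for x
  define G where "G j x = complex_of_real (c j * indicator {of_int j..<of_int j + \<delta>} x * h (x - a * of_int k)) * E x"
    for j :: int and x
  have E_per: "E (of_int j + x) = E x" for j :: int and x
  proof -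
    have "exp (2 * of_real pi * \<i> * of_int m * complex_of_real (of_int j + x))
        = exp (2 * of_real pi * \<i> * of_int m * of_real x) * exp (2 * of_int (m * j) * of_real pi * \<i>)"
      by (simp add: exp_add [symmetric] algebra_simps)
    then show ?thesis unfolding E_def
      using exp_integer_2pi [of "of_int (m * j)"] by simp
  qed
  have E_per': "E (x + of_int j) = E x" for j :: int and x
    using E_per [of j x] by (simp add: add.commute)
  have E1: "cmod (E x) = 1" for x by (simp add: E_def norm_exp_eq_Re)
  have meas_h: "h \<in> borel_measurable borel" using h by (rule borel_measurable_continuous_onI)
  have meas_E: "E \<in> borel_measurable borel"
    unfolding E_def [abs_def] by (intro borel_measurable_continuous_onI continuous_intros)
  note [measurable] = meas_h meas_E
  have G_int: "integrable lborel (G j)" for j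
  proof (rule integrable_bounded_support)
    show "G j \<in> borel_measurable borel" unfolding G_def [abs_def] by measurable
    show "G j x = 0" if "x \<notin> {of_int j..<of_int j + \<delta>}" for x using that by (simp add: G_def)
    show "cmod (G j x) \<le> \<bar>c j\<bar>" for x
    proof -
      have "cmod (G j x) = \<bar>c j\<bar> * (indicator {of_int j..<of_int j + \<delta>} x * \<bar>h (x - a * of_int k)\<bar>)"
        by (simp add: G_def norm_mult E1 abs_mult)
      also have "\<dots> \<le> \<bar>c j\<bar> * 1"
        using h1 by (intro mult_left_mono) (auto simp: indicator_def)
      finally show ?thesis by simp
    qed
  qed
  have "L2_inner (\<lambda>x. complex_of_real (pulse_train c J \<delta> x))
      (gabor_system (\<lambda>x. complex_of_real (h x)) a 1 (k, m)) = (LINT x|lebesgue. (\<Sum>j\<in>J. G j x))"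
    unfolding L2_inner_def gabor_system_def pulse_train_def G_def E_def
    by (simp add: sum_distrib_left sum_distrib_right mult_ac)
  also have "\<dots> = (LINT x|lborel. (\<Sum>j\<in>J. G j x))"
  proof (rule integral_completion)
    show "(\<lambda>x. \<Sum>j\<in>J. G j x) \<in> borel_measurable lborel" unfolding G_def by measurable
  qed
  also have "\<dots> = (\<Sum>j\<in>J. (LINT x|lborel. G j x))"
    using G_int by (intro Bochner_Integration.integral_sum)
  also have "\<dots> = (\<Sum>j\<in>J. (LINT x|lborel. G j (of_int j + x)))"
    by (intro sum.cong refl, subst lborel_integral_real_affine [where c = 1 and t = "of_int j" for j]) auto
  also have "\<dots> = (LINT x|lborel. (\<Sum>j\<in>J. G j (of_int j + x)))"
  proof (rule Bochner_Integration.integral_sum [symmetric])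
    show "integrable lborel (\<lambda>x. G j (of_int j + x))" for j
      using lborel_integrable_real_affine [OF G_int, of 1 "of_int j" j] by simp
  qed
  also have "(\<lambda>x. \<Sum>j\<in>J. G j (of_int j + x))
      = (\<lambda>x. of_real (indicator {0..<\<delta>} x * (\<Sum>j\<in>J. c j * h (x + of_int j - a * of_int k))) * E x)"
    by (auto simp: fun_eq_iff G_def E_per E_per' indicator_def sum_distrib_left sum_distrib_right
        algebra_simps intro!: sum.cong)
  finally show ?thesis by (simp add: E_def)
qed

section \<open>Bounded kernel sequences exclude frames\<close>

text \<open>One of the points \<open>L\<close> and \<open>- L\<close> lies between \<open>j\<close> and \<open>y\<close>, where the exponential factorises. The
  form as a product of two sums lets the sums over \<open>j\<close> and over \<open>y\<close> be bounded separately.\<close>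
lemma exp_abs_split:
  fixes lam L j y :: real
  assumes lam: "lam > 0" and L: "0 \<le> L" and sep: "\<bar>j\<bar> \<le> L \<and> L \<le> \<bar>y\<bar> \<or> \<bar>y\<bar> \<le> L \<and> L \<le> \<bar>j\<bar>"
  shows "exp (- lam * \<bar>j - y\<bar>)
    \<le> (exp (- lam * \<bar>L - j\<bar>) + exp (- lam * \<bar>- L - j\<bar>)) * (exp (- lam * \<bar>L - y\<bar>) + exp (- lam * \<bar>- L - y\<bar>))"
proof -
  have "\<bar>j - y\<bar> = \<bar>L - j\<bar> + \<bar>L - y\<bar> \<or> \<bar>j - y\<bar> = \<bar>- L - j\<bar> + \<bar>- L - y\<bar>"
    using sep L by linarith
  then have "exp (- lam * \<bar>j - y\<bar>) = exp (- lam * \<bar>L - j\<bar>) * exp (- lam * \<bar>L - y\<bar>)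
      \<or> exp (- lam * \<bar>j - y\<bar>) = exp (- lam * \<bar>- L - j\<bar>) * exp (- lam * \<bar>- L - y\<bar>)"
    by (metis distrib_left exp_add)
  moreover have "0 < exp (- lam * \<bar>L - j\<bar>) * exp (- lam * \<bar>L - y\<bar>)"
    "0 < exp (- lam * \<bar>- L - j\<bar>) * exp (- lam * \<bar>- L - y\<bar>)"
    "0 < exp (- lam * \<bar>L - j\<bar>) * exp (- lam * \<bar>- L - y\<bar>)"
    "0 < exp (- lam * \<bar>- L - j\<bar>) * exp (- lam * \<bar>L - y\<bar>)"
    by simp_all
  ultimately show ?thesis
    unfolding distrib_left distrib_right by linarith
qed

lemma square_add_le_twice:
  fixes u v :: real
  assumes "0 \<le> u" "u \<le> 1" "0 \<le> v" "v \<le> 1"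
  shows "(u + v)\<^sup>2 \<le> 2 * (u + v)"
  using assms unfolding power2_eq_square by (intro mult_right_mono) auto

text \<open>A bounded sequence that is not square summable and is annihilated by all rows
  \<open>(h (j - a k))\<^sub>j\<close> of the fibre matrix at 0 violates the lower frame bound. Truncate it to
  \<open>\<bar>j\<bar> \<le> L\<close> and put a pulse of width \<open>\<delta>\<close> and height \<open>c j\<close> at each integer \<open>j\<close>; the squared norm is
  \<open>\<delta> \<Sum> (c j)\<^sup>2\<close>. By Bessel's inequality the frame sum is at most \<open>\<delta>\<close> times the sum over \<open>k\<close> of
  suprema of \<open>\<bar>F k x\<bar>\<^sup>2\<close> on \<open>[0, \<delta>)\<close>. At \<open>x = 0\<close> the full row sum vanishes, so \<open>F k 0\<close> is carried
  by indices separated from \<open>a k\<close> by an end point \<open>\<plusminus> L\<close> and decays away from the two end points;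
  its squares sum to a constant independent of \<open>L\<close>. Passing from 0 to \<open>x\<close> costs at most \<open>\<epsilon>\<^sup>2\<close> times
  the number of pulses, which is bounded once \<open>\<delta>\<close> is chosen after \<open>L\<close>.\<close>
theorem bounded_kernel_sequence_imp_not_frame:
  fixes h :: "real \<Rightarrow> real" and c :: "int \<Rightarrow> real" and a lam C :: real
  assumes a: "a > 0" and lam: "lam > 0"
    and cont: "continuous_on UNIV h"
    and decay: "\<And>x. \<bar>h x\<bar> \<le> exp (- lam * \<bar>x\<bar>)"
    and modulus: "\<And>\<epsilon>. \<epsilon> > 0 \<Longrightarrow>
      \<exists>\<delta>>0. \<forall>x y. 0 \<le> x \<longrightarrow> x \<le> \<delta> \<longrightarrow> \<bar>h (x + y) - h y\<bar> \<le> \<epsilon> * exp (- lam * \<bar>y\<bar>)"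
    and bounded: "\<And>j. \<bar>c j\<bar> \<le> C"
    and large: "\<And>R. \<exists>L::nat. R < (\<Sum>j = - int L..int L. (c j)\<^sup>2)"
    and kernel: "\<And>k::int. ((\<lambda>j. c j * h (of_int j - a * of_int k)) has_sum 0) UNIV"
  shows "\<not> L2_frame (gabor_system (\<lambda>x. complex_of_real (h x)) a 1)"
proof
  assume "L2_frame (gabor_system (\<lambda>x. complex_of_real (h x)) a 1)"
  then obtain A where A: "A > 0"
    and lower: "\<And>f. f \<in> L2_space \<Longrightarrow> A * (norm_L2 f)\<^sup>2 \<le>
      (\<Sum>\<^sub>\<infinity>i. (cmod (L2_inner f (gabor_system (\<lambda>x. complex_of_real (h x)) a 1 i)))\<^sup>2)"
    and summ: "\<And>f. f \<in> L2_space \<Longrightarrow>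
      (\<lambda>i. (cmod (L2_inner f (gabor_system (\<lambda>x. complex_of_real (h x)) a 1 i)))\<^sup>2) summable_on UNIV"
    unfolding L2_frame_def by blast
  obtain S where S0: "S > 0"
    and S: "\<And>y (K :: int set). finite K \<Longrightarrow> (\<Sum>k\<in>K. exp (- lam * \<bar>y - 1 * of_int k\<bar>)) \<le> S"
    using exp_lattice_sum_bounded [OF lam zero_less_one_class.zero_less_one] by blast
  obtain Sa where Sa0: "Sa > 0"
    and Sa: "\<And>y (K :: int set). finite K \<Longrightarrow> (\<Sum>k\<in>K. exp (- lam * \<bar>y - a * of_int k\<bar>)) \<le> Sa"
    using exp_lattice_sum_bounded [OF lam a] by blast
  have C0: "C \<ge> 0" using bounded [of 0] by linarith
  \<comment> \<open>The bound for the frame sum divided by \<open>\<delta>\<close>: boundary part plus perturbation part.\<close>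
  define Q where "Q = 2 * (8 * (C * S)\<^sup>2 * (2 * Sa)) + 2 * (C\<^sup>2 * S * Sa)"
  obtain L :: nat where L: "Q / A < (\<Sum>j = - int L..int L. (c j)\<^sup>2)"
    using large by blast
  define J where "J = {- int L..int L}"
  have J: "finite J" by (simp add: J_def)
  define F where "F k x = (\<Sum>j\<in>J. c j * h (x + of_int j - a * of_int k))" for k :: int and x
  define W where "W k = exp (- lam * \<bar>real L - a * of_int k\<bar>) + exp (- lam * \<bar>- real L - a * of_int k\<bar>)" for k :: int
  have W0: "W k \<ge> 0" for k by (simp add: W_def)

  \<comment> \<open>Used for \<open>T = J\<close> when \<open>a k\<close> lies beyond the truncation range and for \<open>T = - J\<close> otherwise.\<close>
  have tail: "\<bar>\<Sum>\<^sub>\<infinity>j\<in>T. c j * h (of_int j - a * of_int k)\<bar> \<le> 2 * C * S * W k"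
    if T: "\<And>j. j \<in> T \<Longrightarrow> \<bar>of_int j\<bar> \<le> real L \<and> real L \<le> \<bar>a * of_int k\<bar>
        \<or> \<bar>a * of_int k\<bar> \<le> real L \<and> real L \<le> \<bar>of_int j\<bar>" for T k
  proof -
    have fin: "(\<Sum>j\<in>U. norm (c j * h (of_int j - a * of_int k))) \<le> 2 * C * S * W k"
      if U: "finite U" "U \<subseteq> T" for U
    proof -
      have "norm (c j * h (of_int j - a * of_int k))
          \<le> C * W k * (exp (- lam * \<bar>real L - 1 * of_int j\<bar>) + exp (- lam * \<bar>- real L - 1 * of_int j\<bar>))"
        if "j \<in> U" for j
      proof -
        have "norm (c j * h (of_int j - a * of_int k)) \<le> C * exp (- lam * \<bar>of_int j - a * of_int k\<bar>)"
          unfolding real_norm_def abs_mult using bounded decay C0 by (intro mult_mono) auto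
        also have "C * exp (- lam * \<bar>of_int j - a * of_int k\<bar>)
            \<le> C * ((exp (- lam * \<bar>real L - of_int j\<bar>) + exp (- lam * \<bar>- real L - of_int j\<bar>)) * W k)"
          unfolding W_def using T U that by (intro mult_left_mono exp_abs_split lam C0) auto
        finally show ?thesis by (simp add: mult_ac)
      qed
      then have "(\<Sum>j\<in>U. norm (c j * h (of_int j - a * of_int k)))
          \<le> C * W k * ((\<Sum>j\<in>U. exp (- lam * \<bar>real L - 1 * of_int j\<bar>)) + (\<Sum>j\<in>U. exp (- lam * \<bar>- real L - 1 * of_int j\<bar>)))"
        unfolding sum.distrib [symmetric] sum_distrib_left by (rule sum_mono)
      also have "\<dots> \<le> C * W k * (S + S)"
        using C0 W0 U by (intro mult_left_mono add_mono S) auto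
      finally show ?thesis by (simp add: mult_ac)
    qed
    have abs: "(\<lambda>j. norm (c j * h (of_int j - a * of_int k))) summable_on T"
      using fin by (intro nonneg_bdd_above_summable_on bdd_aboveI2) auto
    have "\<bar>\<Sum>\<^sub>\<infinity>j\<in>T. c j * h (of_int j - a * of_int k)\<bar> \<le> (\<Sum>\<^sub>\<infinity>j\<in>T. norm (c j * h (of_int j - a * of_int k)))"
      using norm_infsum_bound [OF abs] by simp
    also have "\<dots> \<le> 2 * C * S * W k"
      using abs fin by (intro infsum_le_finite_sums)
    finally show ?thesis .
  qed
  have F0: "\<bar>F k 0\<bar> \<le> 2 * C * S * W k" for k
  proof (cases "real L \<le> \<bar>a * of_int k\<bar>")
    case True
    have "\<bar>\<Sum>\<^sub>\<infinity>j\<in>J. c j * h (of_int j - a * of_int k)\<bar> \<le> 2 * C * S * W k"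
      using True by (intro tail) (auto simp: J_def)
    then show ?thesis using J by (simp add: F_def)
  next
    case False
    let ?s = "\<lambda>j. c j * h (of_int j - a * of_int k)"
    have tl: "\<bar>\<Sum>\<^sub>\<infinity>j\<in>- J. ?s j\<bar> \<le> 2 * C * S * W k"
      using False by (intro tail) (auto simp: J_def)
    have "?s summable_on - J"
      using kernel [of k] by (meson summable_on_subset_banach has_sum_imp_summable top_greatest)
    then have "(?s has_sum (sum ?s J + infsum ?s (- J))) (J \<union> - J)"
      using J by (intro has_sum_Un_disjoint has_sum_infsum has_sum_finite) auto
    then have "(?s has_sum (sum ?s J + infsum ?s (- J))) UNIV" by simp
    then have "sum ?s J + infsum ?s (- J) = 0"
      using kernel [of k] by (rule has_sum_unique)
    then have "F k 0 = - infsum ?s (- J)" by (simp add: F_def)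
    with tl show ?thesis by simp
  qed

  define N where "N = real (card J)"
  have N0: "N > 0" by (simp add: N_def J_def)
  \<comment> \<open>Small enough for the perturbation, of order \<open>\<epsilon>\<^sup>2 N\<close>, to stay bounded as \<open>L\<close> grows.\<close>
  define \<epsilon> where "\<epsilon> = 1 / (N + 1)"
  have "\<epsilon> * N \<le> 1" "0 < \<epsilon>" "\<epsilon> \<le> 1" using N0 by (auto simp: \<epsilon>_def)
  then have \<epsilon>: "\<epsilon> > 0" "\<epsilon>\<^sup>2 * N \<le> 1"
    using N0 by (simp_all add: power2_eq_square mult_le_one mult.assoc)
  obtain \<delta>0 where \<delta>0: "\<delta>0 > 0"
    "\<And>x y. 0 \<le> x \<Longrightarrow> x \<le> \<delta>0 \<Longrightarrow> \<bar>h (x + y) - h y\<bar> \<le> \<epsilon> * exp (- lam * \<bar>y\<bar>)"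
    using modulus [OF \<epsilon>(1)] by blast
  define \<delta> where "\<delta> = min \<delta>0 1"
  have \<delta>: "0 < \<delta>" "\<delta> \<le> 1" "\<delta> \<le> \<delta>0" using \<delta>0 by (auto simp: \<delta>_def)
  define V where "V k = (\<Sum>j\<in>J. exp (- lam * \<bar>of_int j - a * of_int k\<bar>))" for k :: int
  have V0: "V k \<ge> 0" for k by (simp add: V_def sum_nonneg)
  have V_S: "V k \<le> S" for k
    using S [OF J, of "a * of_int k"] by (simp add: V_def abs_minus_commute)
  have V_sum: "(\<Sum>k\<in>K. V k) \<le> N * Sa" if "finite K" for K
    unfolding V_def N_def by (subst sum.swap) (intro sum_bounded_above Sa that)
  have W_sum: "(\<Sum>k\<in>K. W k) \<le> 2 * Sa" if "finite K" for K
    unfolding W_def sum.distrib using Sa [OF that, of "real L"] Sa [OF that, of "- real L"] by simp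
  define b where "b k = 2 * (8 * (C * S)\<^sup>2 * W k) + 2 * (\<epsilon>\<^sup>2 * C\<^sup>2 * S * V k)" for k
  have F_le: "(F k x)\<^sup>2 \<le> b k" if x: "x \<in> {0..<\<delta>}" for k x
  proof -
    have "\<bar>F k x - F k 0\<bar> \<le> (\<Sum>j\<in>J. C * (\<epsilon> * exp (- lam * \<bar>of_int j - a * of_int k\<bar>)))"
    proof -
      have "F k x - F k 0 = (\<Sum>j\<in>J. c j * (h (x + (of_int j - a * of_int k)) - h (of_int j - a * of_int k)))"
        by (simp add: F_def sum_subtractf [symmetric] algebra_simps)
      also have "\<bar>\<dots>\<bar> \<le> (\<Sum>j\<in>J. C * (\<epsilon> * exp (- lam * \<bar>of_int j - a * of_int k\<bar>)))"
        using bounded \<delta>0 \<delta> x C0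
        by (intro order_trans [OF sum_abs] sum_mono) (auto simp: abs_mult intro!: mult_mono)
      finally show ?thesis .
    qed
    also have "\<dots> = C * \<epsilon> * V k" by (simp add: V_def sum_distrib_left mult_ac)
    finally have "(F k x - F k 0)\<^sup>2 \<le> (C * \<epsilon> * V k)\<^sup>2"
      using C0 \<epsilon> V0 by (simp add: abs_le_square_iff [symmetric])
    also have "\<dots> = \<epsilon>\<^sup>2 * C\<^sup>2 * V k * V k" by (simp add: power2_eq_square)
    also have "\<dots> \<le> \<epsilon>\<^sup>2 * C\<^sup>2 * S * V k"
      using V_S V0 by (intro mult_right_mono mult_left_mono) auto
    finally have 1: "(F k x - F k 0)\<^sup>2 \<le> \<epsilon>\<^sup>2 * C\<^sup>2 * S * V k" .
    have "(F k 0)\<^sup>2 \<le> (2 * C * S * W k)\<^sup>2"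
      using F0 [of k] C0 S0 W0 by (simp add: abs_le_square_iff [symmetric])
    also have "\<dots> = 4 * (C * S)\<^sup>2 * (W k)\<^sup>2" by (simp add: power2_eq_square)
    also have "\<dots> \<le> 4 * (C * S)\<^sup>2 * (2 * W k)"
      unfolding W_def using lam by (intro mult_left_mono square_add_le_twice) auto
    finally have 2: "(F k 0)\<^sup>2 \<le> 8 * (C * S)\<^sup>2 * W k" by simp
    have "(F k x)\<^sup>2 = (F k 0 + (F k x - F k 0))\<^sup>2" by simp
    also have "\<dots> \<le> 2 * (F k 0)\<^sup>2 + 2 * (F k x - F k 0)\<^sup>2"
      using sum_squares_bound [of "F k 0" "F k x - F k 0"] unfolding power2_sum by linarith
    finally show ?thesis using 1 2 unfolding b_def by linarith
  qed
  have b_sum: "(\<Sum>k\<in>K. b k) \<le> Q" if K: "finite K" for K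
  proof -
    have "(\<Sum>k\<in>K. b k) = 2 * (8 * (C * S)\<^sup>2 * (\<Sum>k\<in>K. W k)) + 2 * (\<epsilon>\<^sup>2 * C\<^sup>2 * S * (\<Sum>k\<in>K. V k))"
      by (simp add: b_def sum.distrib sum_distrib_left)
    also have "\<dots> \<le> 2 * (8 * (C * S)\<^sup>2 * (2 * Sa)) + 2 * (\<epsilon>\<^sup>2 * C\<^sup>2 * S * (N * Sa))"
      using S0 W_sum [OF K] V_sum [OF K] by (intro add_mono mult_left_mono) auto
    also have "\<dots> \<le> Q"
    proof -
      have "(\<epsilon>\<^sup>2 * N) * (C\<^sup>2 * S * Sa) \<le> 1 * (C\<^sup>2 * S * Sa)"
        using \<epsilon> S0 Sa0 by (intro mult_right_mono) auto
      then show ?thesis by (simp add: Q_def mult_ac)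
    qed
    finally show ?thesis .
  qed

  define f where "f x = complex_of_real (pulse_train c J \<delta> x)" for x
  have f: "f \<in> L2_space" "(norm_L2 f)\<^sup>2 = \<delta> * (\<Sum>j\<in>J. (c j)\<^sup>2)"
    using pulse_train_in_L2 [OF J \<delta>(1,2)] by (auto simp: f_def [abs_def])
  have meas_h: "h \<in> borel_measurable borel" using cont by (rule borel_measurable_continuous_onI)
  have coeff: "(\<Sum>m\<in>I. (cmod (L2_inner f (gabor_system (\<lambda>x. complex_of_real (h x)) a 1 (k, m))))\<^sup>2)
      \<le> \<delta> * b k" if I: "finite I" for I k
  proof -
    define w where "w x = complex_of_real (indicator {0..<\<delta>} x * F k x)" for x
    have h1: "\<bar>h x\<bar> \<le> 1" for x
      by (rule order_trans [OF decay]) (use lam in simp)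
    have w_meas: "w \<in> borel_measurable borel"
      unfolding w_def [abs_def] F_def using meas_h by measurable
    have w_le: "(cmod (w x))\<^sup>2 \<le> b k" for x
      using F_le [of x k] F_le [of 0 k] \<delta> order_trans [OF zero_le_power2 F_le [of 0 k]]
      by (auto simp: w_def indicator_def)
    have "(\<Sum>m\<in>I. (cmod (LINT x|lborel. w x * cnj (exp (2 * of_real pi * \<i> * of_int m * of_real x))))\<^sup>2)
        \<le> \<delta> * b k"
      by (intro fourier_coefficients_le w_meas w_le \<delta> I) (auto simp: w_def)
    then show ?thesis
      using pulse_train_gabor_inner [OF J \<delta>(1) cont h1, of c a k]
      by (simp add: f_def [abs_def] w_def F_def)
  qed
  have "A * (norm_L2 f)\<^sup>2 \<le> (\<Sum>\<^sub>\<infinity>i. (cmod (L2_inner f (gabor_system (\<lambda>x. complex_of_real (h x)) a 1 i)))\<^sup>2)"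
    using f(1) by (rule lower)
  also have "\<dots> \<le> \<delta> * Q"
  proof (rule infsum_le_finite_sums [OF summ [OF f(1)]])
    fix U :: "(int \<times> int) set"
    assume U: "finite U"
    have "(\<Sum>i\<in>U. (cmod (L2_inner f (gabor_system (\<lambda>x. complex_of_real (h x)) a 1 i)))\<^sup>2)
        \<le> (\<Sum>i\<in>fst ` U \<times> snd ` U. (cmod (L2_inner f (gabor_system (\<lambda>x. complex_of_real (h x)) a 1 i)))\<^sup>2)"
      using U by (intro sum_mono2 finite_cartesian_product finite_imageI subset_fst_snd) auto
    also have "\<dots> = (\<Sum>k\<in>fst ` U. \<Sum>m\<in>snd ` U. (cmod (L2_inner f (gabor_system (\<lambda>x. complex_of_real (h x)) a 1 (k, m))))\<^sup>2)"
      by (subst sum.cartesian_product) (simp add: case_prod_beta)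
    also have "\<dots> \<le> (\<Sum>k\<in>fst ` U. \<delta> * b k)"
      using U by (intro sum_mono coeff) auto
    also have "\<dots> \<le> \<delta> * Q"
      unfolding sum_distrib_left [symmetric] using U \<delta> b_sum by (intro mult_left_mono) auto
    finally show "(\<Sum>i\<in>U. (cmod (L2_inner f (gabor_system (\<lambda>x. complex_of_real (h x)) a 1 i)))\<^sup>2) \<le> \<delta> * Q" .
  qed
  finally have "\<delta> * (A * (\<Sum>j\<in>J. (c j)\<^sup>2)) \<le> \<delta> * Q"
    unfolding f(2) by (simp add: mult_ac)
  then have "A * (\<Sum>j\<in>J. (c j)\<^sup>2) \<le> Q" using \<delta>(1) by simp
  moreover have "Q < A * (\<Sum>j\<in>J. (c j)\<^sup>2)"
    using L A by (simp add: J_def field_simps)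
  ultimately show False by simp
qed

section \<open>The window and its alternating periodisation\<close>

lemma h_win_uminus: "h_win lam (- x) = h_win lam x"
  by (simp add: h_win_def)

lemma h_win_continuous: "continuous_on UNIV (h_win lam)"
  unfolding h_win_def [abs_def] by (intro continuous_intros)

lemma h_win_decay:
  assumes "lam > 0"
  shows "\<bar>h_win lam x\<bar> \<le> exp (- lam * \<bar>x\<bar>)"
proof -
  \<comment> \<open>The window is \<open>u (1 - u)\<^sup>2\<close> with \<open>u = exp (- lam \<bar>x\<bar>)\<close>.\<close>
  define u where "u = exp (- lam * \<bar>x\<bar>)"
  have u: "0 < u" "u \<le> 1" using assms by (auto simp: u_def)
  have "exp (- 2 * lam * \<bar>x\<bar>) = u ^ 2" "exp (- 3 * lam * \<bar>x\<bar>) = u ^ 3"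
    by (simp_all add: u_def exp_of_nat_mult [symmetric] mult.assoc)
  then have "h_win lam x = u - 2 * u ^ 2 + u ^ 3"
    by (simp only: h_win_def u_def)
  then have "h_win lam x = u * (1 - u)\<^sup>2"
    by (simp add: power2_eq_square power3_eq_cube algebra_simps)
  moreover have "u * (1 - u)\<^sup>2 \<le> u * 1"
    using u by (intro mult_left_mono power_le_one) auto
  ultimately have "\<bar>h_win lam x\<bar> \<le> u" using u by simp
  then show ?thesis by (simp only: u_def)
qed

lemma exp_abs_increment_le:
  fixes \<mu> x y :: real
  assumes \<mu>: "\<mu> \<ge> 0" and x: "x \<ge> 0"
  shows "\<bar>exp (- \<mu> * \<bar>x + y\<bar>) - exp (- \<mu> * \<bar>y\<bar>)\<bar> \<le> exp (- \<mu> * \<bar>y\<bar>) * (exp (\<mu> * x) - 1)"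
proof -
  define t where "t = - \<mu> * (\<bar>x + y\<bar> - \<bar>y\<bar>)"
  have "\<bar>t\<bar> = \<mu> * \<bar>\<bar>x + y\<bar> - \<bar>y\<bar>\<bar>" using \<mu> by (simp add: t_def abs_mult)
  also have "\<dots> \<le> \<mu> * x" using \<mu> x by (intro mult_left_mono) auto
  finally have t: "\<bar>t\<bar> \<le> \<mu> * x" .
  have "\<bar>exp t - 1\<bar> \<le> exp \<bar>t\<bar> - 1"
  proof (cases "t \<ge> 0")
    case False
    have "1 + t \<le> exp t" "1 + (- t) \<le> exp (- t)" by (rule exp_ge_add_one_self)+
    moreover have "exp t \<le> 1" "\<bar>t\<bar> = - t" using False by simp_all
    ultimately show ?thesis by linarith
  qed simp
  also have "\<dots> \<le> exp (\<mu> * x) - 1" using t by simp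
  finally have "exp (- \<mu> * \<bar>y\<bar>) * \<bar>exp t - 1\<bar> \<le> exp (- \<mu> * \<bar>y\<bar>) * (exp (\<mu> * x) - 1)"
    by (intro mult_left_mono) auto
  moreover have "exp (- \<mu> * \<bar>x + y\<bar>) - exp (- \<mu> * \<bar>y\<bar>) = exp (- \<mu> * \<bar>y\<bar>) * (exp t - 1)"
    by (simp add: t_def right_diff_distrib exp_add [symmetric] algebra_simps)
  ultimately show ?thesis by (simp add: abs_mult)
qed

text \<open>Each exponential of the window changes by a small multiple of its own value, and hence of
  \<open>exp (- lam \<bar>y\<bar>)\<close>: the decay survives in the modulus of continuity.\<close>
lemma h_win_modulus:
  assumes lam: "lam > 0" and e: "\<epsilon> > 0"
  shows "\<exists>\<delta>>0. \<forall>x y. 0 \<le> x \<longrightarrow> x \<le> \<delta> \<longrightarrow>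
    \<bar>h_win lam (x + y) - h_win lam y\<bar> \<le> \<epsilon> * exp (- lam * \<bar>y\<bar>)"
proof (intro exI conjI allI impI)
  define \<delta> where "\<delta> = ln (1 + \<epsilon> / 4) / (3 * lam)"
  show "\<delta> > 0" using lam e by (simp add: \<delta>_def)
  fix x y :: real
  assume x: "0 \<le> x" "x \<le> \<delta>"
  have inc: "\<bar>exp (- \<mu> * \<bar>x + y\<bar>) - exp (- \<mu> * \<bar>y\<bar>)\<bar> \<le> exp (- lam * \<bar>y\<bar>) * (\<epsilon> / 4)"
    if \<mu>: "lam \<le> \<mu>" "\<mu> \<le> 3 * lam" for \<mu>
  proof -
    have "\<mu> * x \<le> 3 * lam * \<delta>" using \<mu> x lam by (intro mult_mono) auto
    also have "\<dots> = ln (1 + \<epsilon> / 4)" using lam by (simp add: \<delta>_def)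
    finally have "exp (\<mu> * x) \<le> exp (ln (1 + \<epsilon> / 4))" by simp
    then have "exp (\<mu> * x) - 1 \<le> \<epsilon> / 4" using e by simp
    moreover have "exp (- \<mu> * \<bar>y\<bar>) \<le> exp (- lam * \<bar>y\<bar>)"
      using \<mu> by (simp add: mult_right_mono)
    ultimately have "exp (- \<mu> * \<bar>y\<bar>) * (exp (\<mu> * x) - 1) \<le> exp (- lam * \<bar>y\<bar>) * (\<epsilon> / 4)"
      using \<mu> x lam by (intro mult_mono) auto
    with exp_abs_increment_le [of \<mu> x y] \<mu> lam x show ?thesis by linarith
  qed
  have hw: "h_win lam z = exp (- lam * \<bar>z\<bar>) - 2 * exp (- (2 * lam) * \<bar>z\<bar>) + exp (- (3 * lam) * \<bar>z\<bar>)" for z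
    by (simp add: h_win_def)
  have combine: "\<bar>(A - 2 * B + C) - (A' - 2 * B' + C')\<bar> \<le> 4 * r"
    if "\<bar>A - A'\<bar> \<le> r" "\<bar>B - B'\<bar> \<le> r" "\<bar>C - C'\<bar> \<le> r" for A B C A' B' C' r :: real
    using that by linarith
  have "\<bar>h_win lam (x + y) - h_win lam y\<bar> \<le> 4 * (exp (- lam * \<bar>y\<bar>) * (\<epsilon> / 4))"
    unfolding hw using lam by (intro combine inc) auto
  then show "\<bar>h_win lam (x + y) - h_win lam y\<bar> \<le> \<epsilon> * exp (- lam * \<bar>y\<bar>)"
    by (simp add: mult.commute)
qed

lemma H_per_add_period: "H_per lam p (y + real p) = - H_per lam p y"
proof -
  have "H_per lam p y = (\<Sum>\<^sub>\<infinity>n::int. (- 1) powi (n + 1) * h_win lam (y + of_int (n + 1) * real p))"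
    unfolding H_per_def
    by (rule infsum_reindex_bij_betw [symmetric], rule bij_betw_byWitness [of _ "\<lambda>n. n - 1"]) auto
  also have "\<dots> = (\<Sum>\<^sub>\<infinity>n::int. - ((- 1) powi n * h_win lam (y + real p + of_int n * real p)))"
    by (simp add: power_int_add algebra_simps)
  also have "\<dots> = - H_per lam p (y + real p)"
    unfolding H_per_def by (rule infsum_uminus)
  finally show ?thesis by simp
qed

lemma H_per_uminus: "H_per lam p (- y) = H_per lam p y"
proof -
  have "H_per lam p y = (\<Sum>\<^sub>\<infinity>n::int. (- 1) powi (- n) * h_win lam (y + of_int (- n) * real p))"
    unfolding H_per_def
    by (rule infsum_reindex_bij_betw [symmetric], rule bij_betw_byWitness [of _ uminus]) auto
  also have "\<dots> = (\<Sum>\<^sub>\<infinity>n::int. (- 1) powi n * h_win lam (- y + of_int n * real p))"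
  proof (rule infsum_cong)
    fix n :: int
    show "(- 1) powi (- n) * h_win lam (y + of_int (- n) * real p)
        = (- 1) powi n * h_win lam (- y + of_int n * real p)"
      using h_win_uminus [of lam "- y + of_int n * real p"] by (simp add: power_int_minus_one_minus)
  qed
  finally show ?thesis by (simp add: H_per_def)
qed

lemma H_per_has_sum:
  assumes lam: "lam > 0" and p: "p > 0"
  shows "((\<lambda>n::int. (- 1) powi n * h_win lam (y + of_int n * real p)) has_sum H_per lam p y) UNIV"
proof -
  obtain S where S: "\<And>y (K :: int set). finite K \<Longrightarrow> (\<Sum>k\<in>K. exp (- lam * \<bar>y - real p * of_int k\<bar>)) \<le> S"
    using exp_lattice_sum_bounded [of lam "real p"] lam p by (metis of_nat_0_less_iff)
  have "(\<lambda>n::int. norm ((- 1) powi n * h_win lam (y + of_int n * real p))) summable_on UNIV"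
  proof (intro nonneg_bdd_above_summable_on bdd_aboveI2)
    fix K :: "int set"
    assume K: "K \<in> {F. F \<subseteq> UNIV \<and> finite F}"
    have "(\<Sum>n\<in>K. norm ((- 1) powi n * h_win lam (y + of_int n * real p)))
        \<le> (\<Sum>n\<in>K. exp (- lam * \<bar>- y - real p * of_int n\<bar>))"
    proof (rule sum_mono)
      fix n
      have "\<bar>- y - real p * of_int n\<bar> = \<bar>y + of_int n * real p\<bar>"
        by (simp add: mult.commute)
      then show "norm ((- 1) powi n * h_win lam (y + of_int n * real p)) \<le> exp (- lam * \<bar>- y - real p * of_int n\<bar>)"
        using h_win_decay [OF lam, of "y + of_int n * real p"] by (simp add: abs_mult power_int_abs)
    qed
    also have "\<dots> \<le> S" using K by (intro S) auto
    finally show "(\<Sum>n\<in>K. norm ((- 1) powi n * h_win lam (y + of_int n * real p))) \<le> S" .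
  qed auto
  then show ?thesis unfolding H_per_def by (rule has_sum_infsum [OF abs_summable_summable])
qed

section \<open>Antiperiodic sequences and the fibre equations\<close>

definition antiperiodic_ext :: "nat \<Rightarrow> (nat \<Rightarrow> real) \<Rightarrow> int \<Rightarrow> real" where
  "antiperiodic_ext p d j = (- 1) powi (j div int p) * d (nat (j mod int p))"

lemma abs_antiperiodic_ext: "\<bar>antiperiodic_ext p d j\<bar> = \<bar>d (nat (j mod int p))\<bar>"
  by (simp add: antiperiodic_ext_def abs_mult power_int_abs)

lemma antiperiodic_ext_bounded:
  assumes "p > 0"
  shows "\<bar>antiperiodic_ext p d j\<bar> \<le> (\<Sum>i<p. \<bar>d i\<bar>)"
  unfolding abs_antiperiodic_ext using assms
  by (intro member_le_sum) (auto simp: nat_less_iff)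

lemma antiperiodic_ext_not_square_summable:
  assumes i: "i < p" and d: "d i \<noteq> 0"
  shows "\<exists>L::nat. R < (\<Sum>j = - int L..int L. (antiperiodic_ext p d j)\<^sup>2)"
proof -
  obtain n :: nat where n: "R < real n * (d i)\<^sup>2"
    using reals_Archimedean3 [of "(d i)\<^sup>2"] d by auto
  define g where "g q = int i + int q * int p" for q
  have inj: "inj_on g {..<n}" using i by (auto simp: g_def inj_on_def)
  have val: "(antiperiodic_ext p d (g q))\<^sup>2 = (d i)\<^sup>2" for q
  proof -
    have "\<bar>antiperiodic_ext p d (g q)\<bar> = \<bar>d i\<bar>"
      using i by (simp add: abs_antiperiodic_ext g_def)
    then show ?thesis by (metis power2_abs)
  qed
  have "real n * (d i)\<^sup>2 = (\<Sum>j\<in>g ` {..<n}. (antiperiodic_ext p d j)\<^sup>2)"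
    using inj by (simp add: sum.reindex val)
  also have "\<dots> \<le> (\<Sum>j = - int (n * p)..int (n * p). (antiperiodic_ext p d j)\<^sup>2)"
  proof (rule sum_mono2)
    have "i + q * p \<le> n * p" if "q < n" for q
      using i that mult_le_mono1 [of "Suc q" n p] by simp
    then have "g q \<le> int (n * p)" if "q < n" for q
      using that unfolding g_def by (metis of_nat_add of_nat_le_iff of_nat_mult)
    moreover have "0 \<le> g q" for q by (simp add: g_def)
    ultimately show "g ` {..<n} \<subseteq> {- int (n * p)..int (n * p)}"
      by (force intro: order_trans [of _ 0])
  qed auto
  finally show ?thesis using n by (intro exI [of _ "n * p"]) linarith
qed

definition fiber_sum :: "(real \<Rightarrow> real) \<Rightarrow> real \<Rightarrow> nat \<Rightarrow> (nat \<Rightarrow> real) \<Rightarrow> int \<Rightarrow> real" where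
  "fiber_sum H a p d k = (\<Sum>i<p. d i * H (real i - a * of_int k))"

text \<open>Splitting \<open>j = i + n p\<close> collects the sign \<open>(- 1)\<^sup>n\<close> and the shift by \<open>n p\<close> into the alternating
  periodisation, so an infinite row equation becomes an equation in \<open>p\<close> unknowns.\<close>
lemma antiperiodic_ext_has_sum:
  assumes lam: "lam > 0" and p: "p > 0"
  shows "((\<lambda>j. antiperiodic_ext p d j * h_win lam (of_int j - a * of_int k)) has_sum
    fiber_sum (H_per lam p) a p d k) UNIV"
proof -
  let ?f = "\<lambda>j. antiperiodic_ext p d j * h_win lam (of_int j - a * of_int k)"
  let ?g = "\<lambda>(i::nat) (n::int). int i + n * int p"
  have "(?f has_sum (\<Sum>i<p. d i * H_per lam p (real i - a * of_int k))) (\<Union>i\<in>{..<p}. range (?g i))"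
  proof (rule sum_has_sum)
    fix i assume i: "i \<in> {..<p}"
    have "?f (?g i n) = d i * ((- 1) powi n * h_win lam (real i - a * of_int k + of_int n * real p))" for n
      using i by (simp add: antiperiodic_ext_def algebra_simps)
    then have "((?f \<circ> ?g i) has_sum d i * H_per lam p (real i - a * of_int k)) UNIV"
      using has_sum_cmult_right [OF H_per_has_sum [OF lam p]] by (simp add: o_def)
    then show "(?f has_sum d i * H_per lam p (real i - a * of_int k)) (range (?g i))"
      using p by (subst has_sum_reindex) (auto simp: inj_on_def)
  next
    fix i i' assume "i \<in> {..<p}" "i' \<in> {..<p}" "i \<noteq> i'"
    then show "range (?g i) \<inter> range (?g i') = {}"
    proof -
      have "?g i n mod int p = int i" "?g i' n mod int p = int i'" for n
        using \<open>i \<in> {..<p}\<close> \<open>i' \<in> {..<p}\<close> by simp_all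
      with \<open>i \<noteq> i'\<close> show ?thesis by (metis (no_types, lifting) disjoint_iff image_iff of_nat_eq_iff)
    qed
  qed simp
  moreover have "(\<Union>i\<in>{..<p}. range (?g i)) = UNIV"
  proof (intro equalityI subsetI UNIV_I)
    fix j
    have "j \<in> range (?g (nat (j mod int p)))"
      using p by (intro range_eqI [of _ _ "j div int p"]) simp
    moreover have "nat (j mod int p) \<in> {..<p}" using p by (simp add: nat_less_iff)
    ultimately show "j \<in> (\<Union>i\<in>{..<p}. range (?g i))" by (rule UN_I [rotated])
  qed
  ultimately show ?thesis by (simp add: fiber_sum_def)
qed

text \<open>The condition on \<open>d\<close> says that its antiperiodic extension has parity \<open>\<sigma>\<close>; as \<open>H\<close> is even, the
  row equations inherit that parity in \<open>k\<close>.\<close>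
lemma fiber_sum_uminus:
  assumes per: "\<And>y. H (y + real p) = - H y" and ev: "\<And>y. H (- y) = H y" and p: "p > 0"
    and d0: "d 0 = \<sigma> * d 0" and d: "\<And>i. 1 \<le> i \<Longrightarrow> i < p \<Longrightarrow> d i = - \<sigma> * d (p - i)"
  shows "fiber_sum H a p d (- k) = \<sigma> * fiber_sum H a p d k"
proof -
  have split: "sum f {..<p} = f 0 + sum f {1..<p}" for f :: "nat \<Rightarrow> real"
    using sum.atLeast_Suc_lessThan [OF p, of f] by (simp add: lessThan_atLeast0)
  have "(\<Sum>i\<in>{1..<p}. d i * H (real i - a * of_int (- k)))
      = (\<Sum>i\<in>{1..<p}. \<sigma> * (d (p - i) * H (real (p - i) - a * of_int k)))"
  proof (rule sum.cong [OF refl])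
    fix i assume i: "i \<in> {1..<p}"
    have "H (real (p - i) - a * of_int k) = - H (- (real i - a * of_int (- k)))"
      using i per [of "- (real i - a * of_int (- k))"] by (simp add: of_nat_diff algebra_simps)
    with d [of i] i show "d i * H (real i - a * of_int (- k)) = \<sigma> * (d (p - i) * H (real (p - i) - a * of_int k))"
      by (simp only: ev) simp
  qed
  also have "\<dots> = (\<Sum>i\<in>{1..<p}. \<sigma> * (d i * H (real i - a * of_int k)))"
    by (rule sum.reindex_bij_witness [of _ "\<lambda>i. p - i" "\<lambda>i. p - i"]) auto
  finally have "fiber_sum H a p d (- k)
      = d 0 * H (a * of_int k) + (\<Sum>i\<in>{1..<p}. \<sigma> * (d i * H (real i - a * of_int k)))"
    by (simp add: fiber_sum_def split)
  also have "d 0 * H (a * of_int k) = \<sigma> * (d 0 * H (real 0 - a * of_int k))"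
    unfolding mult.assoc [symmetric] d0 [symmetric] using ev [of "a * of_int k"] by simp
  finally show ?thesis by (simp add: fiber_sum_def split sum_distrib_left distrib_left)
qed

text \<open>Here the value \<open>a = p / (p + 1)\<close> enters: advancing \<open>k\<close> by \<open>p + 1\<close> translates by exactly one
  antiperiod.\<close>
lemma fiber_sum_shift:
  assumes per: "\<And>y. H (y + real p) = - H y" and a: "a * (real p + 1) = real p"
  shows "fiber_sum H a p d (k - int (p + 1)) = - fiber_sum H a p d k"
proof -
  have "real i - a * of_int (k - int (p + 1)) = (real i - a * of_int k) + real p" for i
    using a by (simp add: algebra_simps)
  then show ?thesis by (simp only: fiber_sum_def per) (simp add: sum_negf)
qed

text \<open>Reflection and the shift by \<open>p + 1\<close> bring every index into the range from 0 to \<open>(p + 1) / 2\<close>,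
  so about half as many equations as a period contains remain, to match the unknowns halved by parity.\<close>
lemma fiber_sum_eq_0:
  assumes per: "\<And>y. H (y + real p) = - H y" and a: "a * (real p + 1) = real p"
    and reflect: "\<And>k. fiber_sum H a p d (- k) = \<sigma> * fiber_sum H a p d k"
    and base: "\<And>s. s \<le> (p + 1) div 2 \<Longrightarrow> fiber_sum H a p d (int s) = 0"
  shows "fiber_sum H a p d k = 0"
proof -
  have nat_case: "fiber_sum H a p d (int n) = 0" for n
  proof (induction n rule: less_induct)
    case (less n)
    show ?case
    proof (cases "n \<le> (p + 1) div 2")
      case False
      have shift: "fiber_sum H a p d (int n) = - fiber_sum H a p d (int n - int (p + 1))"
        using fiber_sum_shift [of H p a d "int n", OF per a] by simp
      show ?thesis
      proof (cases "p + 1 \<le> n")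
        case True
        then have "fiber_sum H a p d (int (n - (p + 1))) = 0" by (intro less) auto
        with True shift show ?thesis by (simp add: of_nat_diff)
      next
        case small: False
        then have "fiber_sum H a p d (int (p + 1 - n)) = 0" using False by (intro base) auto
        moreover have "int n - int (p + 1) = - int (p + 1 - n)" using small by simp
        ultimately show ?thesis
          using shift reflect [of "int (p + 1 - n)"] by (simp only: mult_zero_right minus_zero)
      qed
    qed (rule base)
  qed
  show ?thesis
  proof (cases "k \<ge> 0")
    case True
    then show ?thesis using nat_case [of "nat k"] by simp
  next
    case False
    then have "k = - int (nat (- k))" by simp
    then show ?thesis using reflect [of "int (nat (- k))"] nat_case [of "nat (- k)"] by simp
  qed
qed

section \<open>Reduction to the determinant\<close>

lemma sum_lessThan_fold_even:
  fixes f :: "nat \<Rightarrow> real"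
  assumes "m > 0"
  shows "(\<Sum>i<2 * m. f i) = f 0 + (\<Sum>i=1..<m. f i + f (2 * m - i)) + f m"
proof -
  have "sum f {Suc m..<2 * m} = (\<Sum>i=1..<m. f (2 * m - i))"
    by (rule sum.reindex_bij_witness [of _ "\<lambda>i. 2 * m - i" "\<lambda>i. 2 * m - i"]) auto
  moreover have "sum f {..<2 * m} = sum f {0..<m} + sum f {m..<2 * m}"
    by (simp add: sum.atLeastLessThan_concat lessThan_atLeast0)
  moreover have "sum f {0..<m} = f 0 + sum f {1..<m}" "sum f {m..<2 * m} = f m + sum f {Suc m..<2 * m}"
    using assms by (simp_all add: sum.atLeast_Suc_lessThan)
  ultimately show ?thesis by (simp add: sum.distrib)
qed

lemma sum_lessThan_fold_odd:
  fixes f :: "nat \<Rightarrow> real"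
  assumes "m > 0"
  shows "(\<Sum>i<2 * m - 1. f i) = f 0 + (\<Sum>i=1..<m. f i + f (2 * m - 1 - i))"
proof -
  have "sum f {m..<2 * m - 1} = (\<Sum>i=1..<m. f (2 * m - 1 - i))"
    by (rule sum.reindex_bij_witness [of _ "\<lambda>i. 2 * m - 1 - i" "\<lambda>i. 2 * m - 1 - i"]) auto
  moreover have "sum f {..<2 * m - 1} = sum f {0..<m} + sum f {m..<2 * m - 1}"
    using assms by (simp add: sum.atLeastLessThan_concat lessThan_atLeast0)
  moreover have "sum f {0..<m} = f 0 + sum f {1..<m}"
    using assms by (simp add: sum.atLeast_Suc_lessThan)
  ultimately show ?thesis by (simp add: sum.distrib)
qed

lemma singular_matrix_kernel:
  fixes A :: "real mat"
  assumes A: "A \<in> carrier_mat m m" and det: "Determinant.det A = 0"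
  obtains v :: "nat \<Rightarrow> real" and j where "j < m" "v j \<noteq> 0"
    and "\<And>i. i < m \<Longrightarrow> (\<Sum>j<m. A $$ (i, j) * v j) = 0"
proof -
  obtain w where w: "w \<in> carrier_vec m" "w \<noteq> 0\<^sub>v m" "A *\<^sub>v w = 0\<^sub>v m"
    using det det_0_iff_vec_prod_zero_field [OF A] by blast
  have "\<exists>j<m. vec_index w j \<noteq> 0"
  proof (rule ccontr)
    assume "\<not> ?thesis"
    then have "w = 0\<^sub>v m" using w(1) by (intro eq_vecI) auto
    with w(2) show False by simp
  qed
  moreover have "(\<Sum>j<m. A $$ (i, j) * vec_index w j) = 0" if i: "i < m" for i
  proof -
    have "vec_index (A *\<^sub>v w) i = (\<Sum>j<m. A $$ (i, j) * vec_index w j)"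
      using A w(1) i by (simp add: scalar_prod_def lessThan_atLeast0)
    then show ?thesis using w(3) i by simp
  qed
  ultimately show ?thesis using that by blast
qed

lemma antiperiodic_even_reflection:
  fixes H :: "real \<Rightarrow> real"
  assumes per: "\<And>y. H (y + real p) = - H y" and ev: "\<And>y. H (- y) = H y"
  shows "H x = - H (real p - x)"
  using per [of "- x"] ev [of x] by simp

text \<open>For even \<open>p = 2 m\<close> an odd antiperiodic sequence satisfies \<open>d (p - i) = d i\<close> and is determined by
  \<open>d 1, \<dots>, d m\<close>; folding \<open>i\<close> with \<open>p - i\<close> produces the columns of \<open>B_plus\<close>, the middle index \<open>m\<close> being
  its own partner.\<close>
lemma fiber_sum_odd_coefficients:
  assumes per: "\<And>y. H (y + real p) = - H y" and ev: "\<And>y. H (- y) = H y"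
    and m: "m > 0" and p: "p = 2 * m"
    and d0: "d 0 = 0" and d: "\<And>i. 1 \<le> i \<Longrightarrow> i < m \<Longrightarrow> d (p - i) = d i"
  shows "fiber_sum H a p d (int s) =
    - ((\<Sum>k=1..<m. d k * (H (a * real s + real k) + H (a * real s + real p - real k)))
       + d m * H (a * real s + real p / 2))"
proof -
  note R = antiperiodic_even_reflection [of H p, OF per ev]
  have 1: "d k * H (real k - a * real s) + d (p - k) * H (real (p - k) - a * real s)
      = - (d k * (H (a * real s + real k) + H (a * real s + real p - real k)))"
    if "k \<in> {1..<m}" for k
  proof -
    have "H (real k - a * real s) = - H (a * real s + real p - real k)"
      using R [of "real k - a * real s"] by (simp add: algebra_simps)
    moreover have "H (real (p - k) - a * real s) = - H (a * real s + real k)"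
      using R [of "real (p - k) - a * real s"] that p by (simp add: of_nat_diff algebra_simps)
    ultimately show ?thesis using d [of k] that by (simp add: algebra_simps)
  qed
  have 2: "H (real m - a * real s) = - H (a * real s + real p / 2)"
    using R [of "real m - a * real s"] p by (simp add: algebra_simps)
  have S: "(\<Sum>k=1..<m. d k * H (real k - a * real s) + d (p - k) * H (real (p - k) - a * real s))
      = (\<Sum>k=1..<m. - (d k * (H (a * real s + real k) + H (a * real s + real p - real k))))"
    by (intro sum.cong refl 1)
  have "fiber_sum H a p d (int s) = (\<Sum>k=1..<m. d k * H (real k - a * real s) + d (p - k) * H (real (p - k) - a * real s))
      + d m * H (real m - a * real s)"
    unfolding fiber_sum_def using sum_lessThan_fold_even [OF m, of "\<lambda>i. d i * H (real i - a * real s)"] p d0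
    by simp
  also have "\<dots> = (\<Sum>k=1..<m. - (d k * (H (a * real s + real k) + H (a * real s + real p - real k))))
      - d m * H (a * real s + real p / 2)"
    unfolding S using 2 by simp
  finally show ?thesis by (simp add: sum_negf)
qed

text \<open>For odd \<open>p = 2 m - 1\<close> an even antiperiodic sequence satisfies \<open>d (p - i) = - d i\<close> and is
  determined by \<open>d 0, \<dots>, d (m - 1)\<close>; here 0 is the only index without a partner.\<close>
lemma fiber_sum_even_coefficients:
  assumes per: "\<And>y. H (y + real p) = - H y" and ev: "\<And>y. H (- y) = H y"
    and m: "m > 0" and p: "p = 2 * m - 1"
    and d: "\<And>i. 1 \<le> i \<Longrightarrow> i < m \<Longrightarrow> d (p - i) = - d i"
  shows "fiber_sum H a p d (int s) = d 0 * H (a * real s)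
    + (\<Sum>k=1..<m. d k * (H (a * real s + real k) - H (a * real s + real p - real k)))"
proof -
  note R = antiperiodic_even_reflection [of H p, OF per ev]
  have 1: "d k * H (real k - a * real s) + d (p - k) * H (real (p - k) - a * real s)
      = d k * (H (a * real s + real k) - H (a * real s + real p - real k))"
    if "k \<in> {1..<m}" for k
  proof -
    have "H (real k - a * real s) = - H (a * real s + real p - real k)"
      using R [of "real k - a * real s"] by (simp add: algebra_simps)
    moreover have "H (real (p - k) - a * real s) = - H (a * real s + real k)"
      using R [of "real (p - k) - a * real s"] that p by (simp add: of_nat_diff algebra_simps)
    ultimately show ?thesis using d [of k] that by (simp add: algebra_simps)
  qed
  have S: "(\<Sum>k=1..<m. d k * H (real k - a * real s) + d (p - k) * H (real (p - k) - a * real s))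
      = (\<Sum>k=1..<m. d k * (H (a * real s + real k) - H (a * real s + real p - real k)))"
    by (intro sum.cong refl 1)
  have "fiber_sum H a p d (int s) = d 0 * H (- (a * real s))
      + (\<Sum>k=1..<m. d k * H (real k - a * real s) + d (p - k) * H (real (p - k) - a * real s))"
    unfolding fiber_sum_def using sum_lessThan_fold_odd [OF m, of "\<lambda>i. d i * H (real i - a * real s)"] p
    by simp
  then show ?thesis
    unfolding S by (simp add: ev)
qed

lemma B_plus_singular_imp_kernel:
  fixes \<beta> :: real
  assumes m: "m > 0" and p: "p = 2 * m" and det: "Determinant.det (B_plus p \<beta>) = 0"
  defines "a \<equiv> shift_par p" and "H \<equiv> H_per (lam_par p \<beta>) p"
  obtains d i where "i < p" "d i \<noteq> 0" "\<And>k. fiber_sum H a p d k = 0"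
proof -
  have H: "H (y + real p) = - H y" "H (- y) = H y" for y
    by (simp_all add: H_def H_per_add_period H_per_uminus)
  have carrier: "B_plus p \<beta> \<in> carrier_mat m m" by (simp add: B_plus_def p Let_def)
  obtain v j where j: "j < m" "v j \<noteq> 0"
    and v: "\<And>i. i < m \<Longrightarrow> (\<Sum>j<m. B_plus p \<beta> $$ (i, j) * v j) = 0"
    using singular_matrix_kernel [OF carrier det] by metis
  \<comment> \<open>The factor \<open>sqrt 2\<close> at the middle index absorbs the normalisation of the last column.\<close>
  define d where "d k = (if k = 0 then 0 else if k < m then v (k - 1)
    else if k = m then sqrt 2 * v (m - 1) else v (p - k - 1))" for k
  have dj: "d (j + 1) \<noteq> 0" "j + 1 < p"
    using j p by (cases "j + 1 = m"; auto simp: d_def)+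
  have d_sym: "d i = d (p - i)" if "1 \<le> i" "i < p" for i
    using that p by (auto simp: d_def)
  have reflect: "fiber_sum H a p d (- k) = - 1 * fiber_sum H a p d k" for k
  proof (rule fiber_sum_uminus [OF H])
    show "d i = - (- 1) * d (p - i)" if "1 \<le> i" "i < p" for i
      using d_sym [OF that] by simp
  qed (use m p in \<open>simp_all add: d_def\<close>)
  have base: "fiber_sum H a p d (int s) = 0" if s: "s \<le> (p + 1) div 2" for s
  proof (cases "s = 0")
    \<comment> \<open>No row of the matrix belongs to \<open>s = 0\<close>: an odd function vanishes at 0.\<close>
    case True
    then show ?thesis using reflect [of 0] by simp
  next
    case False
    let ?T = "\<lambda>k. H (a * real s + real k) + H (a * real s + real p - real k)"
    let ?U = "H (a * real s + real p / 2)"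
    have s_le: "s - 1 < m" "s - 1 + 1 = s" using False s p by auto
    have entry: "B_plus p \<beta> $$ (s - 1, k - 1) * v (k - 1) = sqrt (real p) * (d k * ?T k)"
      if "k \<in> {1..<m}" for k
    proof -
      have "1 \<le> k" "k < m" "k - 1 < m" "k - 1 + 1 = k" using that by auto
      then show ?thesis
        using s_le p False by (simp add: B_plus_def Let_def d_def a_def H_def)
    qed
    have entry_m: "B_plus p \<beta> $$ (s - 1, m - 1) * v (m - 1) = sqrt (real p) * (d m * ?U)"
      using m s_le p False by (simp add: B_plus_def Let_def d_def a_def H_def real_sqrt_mult)
    have "0 = (\<Sum>j<m. B_plus p \<beta> $$ (s - 1, j) * v j)" using v s_le by simp
    also have "\<dots> = (\<Sum>k=1..<m. B_plus p \<beta> $$ (s - 1, k - 1) * v (k - 1)) + B_plus p \<beta> $$ (s - 1, m - 1) * v (m - 1)"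
    proof -
      have "{..<m} = insert (m - 1) {..<m - 1}" using m by auto
      moreover have "(\<Sum>j<m - 1. B_plus p \<beta> $$ (s - 1, j) * v j) = (\<Sum>k=1..<m. B_plus p \<beta> $$ (s - 1, k - 1) * v (k - 1))"
        by (rule sum.reindex_bij_witness [of _ "\<lambda>k. k - 1" "\<lambda>j. j + 1"]) auto
      ultimately show ?thesis by simp
    qed
    also have "\<dots> = sqrt (real p) * ((\<Sum>k=1..<m. d k * ?T k) + d m * ?U)"
    proof -
      have "(\<Sum>k=1..<m. B_plus p \<beta> $$ (s - 1, k - 1) * v (k - 1)) = (\<Sum>k=1..<m. sqrt (real p) * (d k * ?T k))"
        by (intro sum.cong refl entry)
      then show ?thesis using entry_m by (simp only: sum_distrib_left distrib_left)
    qed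
    finally have "(\<Sum>k=1..<m. d k * ?T k) + d m * ?U = 0" using p m by simp
    moreover have "fiber_sum H a p d (int s) = - ((\<Sum>k=1..<m. d k * ?T k) + d m * ?U)"
    proof (intro fiber_sum_odd_coefficients H m p)
      fix i assume "1 \<le> i" "i < m"
      with d_sym [of i] p show "d (p - i) = d i" by simp
    qed (simp add: d_def)
    ultimately show ?thesis by simp
  qed
  have a: "a * (real p + 1) = real p" by (simp add: a_def shift_par_def)
  show ?thesis
    by (rule that [OF dj(2,1) fiber_sum_eq_0 [OF H(1) a reflect base]])
qed

lemma B_minus_singular_imp_kernel:
  fixes \<beta> :: real
  assumes m: "m > 0" and p: "p = 2 * m - 1" and det: "Determinant.det (B_minus p \<beta>) = 0"
  defines "a \<equiv> shift_par p" and "H \<equiv> H_per (lam_par p \<beta>) p"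
  obtains d i where "i < p" "d i \<noteq> 0" "\<And>k. fiber_sum H a p d k = 0"
proof -
  have H: "H (y + real p) = - H y" "H (- y) = H y" for y
    by (simp_all add: H_def H_per_add_period H_per_uminus)
  have m_eq: "(p + 1) div 2 = m" and p0: "p > 0" using p m by auto
  have carrier: "B_minus p \<beta> \<in> carrier_mat m m" unfolding B_minus_def m_eq Let_def by simp
  obtain v j where j: "j < m" "v j \<noteq> 0"
    and v: "\<And>i. i < m \<Longrightarrow> (\<Sum>j<m. B_minus p \<beta> $$ (i, j) * v j) = 0"
    using singular_matrix_kernel [OF carrier det] by metis
  \<comment> \<open>Dividing by \<open>sqrt 2\<close> off the index 0 undoes the normalisation of the columns.\<close>
  define d where "d k = (if k = 0 then v 0 else if k < m then v k / sqrt 2 else - (v (p - k) / sqrt 2))" for k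
  have dj: "d j \<noteq> 0" "j < p"
    using j p by (auto simp: d_def)
  have d_anti: "d i = - d (p - i)" if i: "1 \<le> i" "i < p" for i
  proof (cases "i < m")
    case True
    then have "p - i \<noteq> 0" "\<not> p - i < m" "p - (p - i) = i" using i p by linarith+
    with True i show ?thesis by (simp add: d_def)
  next
    case False
    then have "p - i \<noteq> 0" "p - i < m" using i p by linarith+
    with False i show ?thesis by (simp add: d_def)
  qed
  have reflect: "fiber_sum H a p d (- k) = 1 * fiber_sum H a p d k" for k
  proof (rule fiber_sum_uminus [OF H])
    show "d i = - 1 * d (p - i)" if "1 \<le> i" "i < p" for i
      using d_anti [OF that] by simp
  qed (use p0 in simp_all)
  have a: "a * (real p + 1) = real p" by (simp add: a_def shift_par_def)
  have base: "fiber_sum H a p d (int s) = 0" if s: "s \<le> (p + 1) div 2" for s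
  proof (cases "s = m")
    \<comment> \<open>The shift by \<open>p + 1 = 2 m\<close> sends \<open>m\<close> to \<open>- m\<close> with a sign change, evenness without one.\<close>
    case True
    have "int m - int (p + 1) = - int m" using p m by simp
    then have "fiber_sum H a p d (- int m) = - fiber_sum H a p d (int m)"
      using fiber_sum_shift [of H p a d "int m", OF H(1) a] by (simp only:)
    with reflect [of "int m"] show ?thesis using True by simp
  next
    case False
    then have s_less: "s < m" using s m_eq by simp
    let ?T = "\<lambda>k. H (a * real s + real k) - H (a * real s + real p - real k)"
    \<comment> \<open>The remaining normalisation of the rows: row 0 differs from the others by \<open>sqrt 2\<close>.\<close>
    define r where "r = (if s = 0 then 1 else sqrt 2 :: real)"
    have r: "r \<noteq> 0" by (simp add: r_def)
    have entry_0: "B_minus p \<beta> $$ (s, 0) * v 0 = sqrt (real p) * r * (d 0 * H (a * real s))"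
      unfolding B_minus_def m_eq Let_def using m s_less
      by (simp add: d_def a_def H_def r_def real_sqrt_mult)
    have entry: "B_minus p \<beta> $$ (s, k) * v k = sqrt (real p) * r * (d k * ?T k)"
      if k: "k \<in> {1..<m}" for k
    proof (cases "s = 0")
      case True
      have "H (real p - real k) = - H (real k)"
        using antiperiodic_even_reflection [of H p "real k"] H by simp
      moreover have "v k = sqrt 2 * d k" using k by (simp add: d_def)
      moreover have "B_minus p \<beta> $$ (s, k) = sqrt (2 * real p) * H (real k)"
        unfolding B_minus_def m_eq Let_def using True k m by (simp add: H_def)
      ultimately show ?thesis using True by (simp add: r_def real_sqrt_mult)
    next
      case s0: False
      have "v k = sqrt 2 * d k" using k by (simp add: d_def)
      moreover have "B_minus p \<beta> $$ (s, k) = sqrt (real p) * ?T k"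
        unfolding B_minus_def m_eq Let_def using s0 s_less k by (simp add: H_def a_def)
      ultimately show ?thesis using s0 by (simp add: r_def)
    qed
    have "0 = (\<Sum>j<m. B_minus p \<beta> $$ (s, j) * v j)" using v s_less by simp
    also have "\<dots> = B_minus p \<beta> $$ (s, 0) * v 0 + (\<Sum>k=1..<m. B_minus p \<beta> $$ (s, k) * v k)"
      using sum.atLeast_Suc_lessThan [OF m, of "\<lambda>k. B_minus p \<beta> $$ (s, k) * v k"]
      by (simp add: lessThan_atLeast0)
    also have "\<dots> = sqrt (real p) * r * (d 0 * H (a * real s) + (\<Sum>k=1..<m. d k * ?T k))"
    proof -
      have "(\<Sum>k=1..<m. B_minus p \<beta> $$ (s, k) * v k) = (\<Sum>k=1..<m. sqrt (real p) * r * (d k * ?T k))"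
        by (intro sum.cong refl entry)
      then show ?thesis using entry_0 by (simp only: sum_distrib_left distrib_left)
    qed
    finally have "d 0 * H (a * real s) + (\<Sum>k=1..<m. d k * ?T k) = 0" using p0 r by simp
    moreover have "fiber_sum H a p d (int s) = d 0 * H (a * real s) + (\<Sum>k=1..<m. d k * ?T k)"
    proof (intro fiber_sum_even_coefficients H m p)
      fix i assume "1 \<le> i" "i < m"
      with d_anti [of i] p show "d (p - i) = - d i" by simp
    qed
    ultimately show ?thesis by simp
  qed
  show ?thesis
    by (rule that [OF dj(2,1) fiber_sum_eq_0 [OF H(1) a reflect base]])
qed

section \<open>The frame property fails\<close>

theorem mainTheorem6:
  fixes p :: nat and \<beta> a lam :: real
  assumes "p \<ge> 2" and "\<beta> > 0"
    and "a = real p / (real p + 1)" and "lam = 2 * pi * \<beta> / a"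
    and "Delta p \<beta> = 0"
  shows "\<not> L2_frame (gabor_system (\<lambda>x. complex_of_real (h_win lam x)) a 1)"
proof -
  have p: "p > 0" using assms(1) by simp
  have a: "a > 0" "a = shift_par p" "a * (real p + 1) = real p"
    using assms(1,3) by (auto simp: shift_par_def)
  have lam: "lam > 0" "lam = lam_par p \<beta>"
    using assms(2,4) a by (auto simp: lam_par_def)
  let ?H = "H_per lam p"
  have "\<exists>d i. i < p \<and> d i \<noteq> 0 \<and> (\<forall>k. fiber_sum ?H a p d k = 0)"
  proof (cases "even p")
    case True
    then obtain m where m: "p = 2 * m" by blast
    have det: "Determinant.det (B_plus p \<beta>) = 0" using assms(5) True by (simp add: Delta_def)
    have m0: "m > 0" using m p by simp
    show ?thesis
      unfolding a(2) lam(2) by (rule B_plus_singular_imp_kernel [OF m0 m det]) blast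
  next
    case False
    then have m: "p = 2 * ((p + 1) div 2) - 1" "(p + 1) div 2 > 0" using p by (auto elim!: oddE)
    have det: "Determinant.det (B_minus p \<beta>) = 0" using assms(5) False by (simp add: Delta_def)
    show ?thesis
      unfolding a(2) lam(2) by (rule B_minus_singular_imp_kernel [OF m(2,1) det]) blast
  qed
  then obtain d i where i: "i < p" "d i \<noteq> 0" and zero: "\<And>k. fiber_sum ?H a p d k = 0"
    by blast
  show ?thesis
  proof (rule bounded_kernel_sequence_imp_not_frame [where lam = lam])
    show "((\<lambda>j. antiperiodic_ext p d j * h_win lam (of_int j - a * of_int k)) has_sum 0) UNIV" for k
      using antiperiodic_ext_has_sum [OF lam(1) p, of d a k] by (simp add: zero)
    show "\<bar>h_win lam x\<bar> \<le> exp (- lam * \<bar>x\<bar>)" for x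
      by (rule h_win_decay [OF lam(1)])
    show "\<exists>\<delta>>0. \<forall>x y. 0 \<le> x \<longrightarrow> x \<le> \<delta> \<longrightarrow>
        \<bar>h_win lam (x + y) - h_win lam y\<bar> \<le> \<epsilon> * exp (- lam * \<bar>y\<bar>)" if "\<epsilon> > 0" for \<epsilon>
      by (rule h_win_modulus [OF lam(1) that])
    show "\<bar>antiperiodic_ext p d j\<bar> \<le> (\<Sum>i<p. \<bar>d i\<bar>)" for j
      by (rule antiperiodic_ext_bounded [OF p])
    show "\<exists>L::nat. R < (\<Sum>j = - int L..int L. (antiperiodic_ext p d j)\<^sup>2)" for R
      by (rule antiperiodic_ext_not_square_summable [of i p d, OF i])
  qed (rule a(1) lam(1) h_win_continuous)+
qed

end
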